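(* Let $m,n\ge1$ be integers, let $\overline A$ be the transfer matrix indexed by cyclic signatures of length $m$, and let $G_{\overline m\times\overline n}(z)$ denote the domination polynomial of the $m\times n$ torus graph. Then $$G_{\overline m\times\overline n}(z)=\operatorname{Tr}\overline A^{\,n}.$$
   Context: Dominating set: a subset $S\subseteq V$ of the vertices of a graph $G=(V,E)$ such that every vertex of $V$ is in $S$ or has a neighbor in $S$. Domination polynomial of $G$: $D_G(z)=\sum_S z^{|S|}$, the sum over all dominating sets $S$ of $G$. The $m\times n$ torus graph is the Cartesian product $C_m\square C_n$, where $C_k$ is the cycle graph on $k$ vertices (vertices $\mathbb Z/k$, with distinct $i,j$ adjacent iff $j=i\pm1\bmod k$, so $C_1$ and $C_2$ are a single vertex and a single edge). Cyclic signatures: the alphabet is $\{\mathtt u,\mathtt c,\mathtt o\}$ (uncovered, covered, occupied). A cyclic signature of length $m$ is a string $\sigma=(\sigma_1,\ldots,\sigma_m)$ over this alphabet containing neither of the substrings $(\mathtt u,\mathtt o)$ and $(\mathtt o,\mathtt u)$ in consecutive positions, and such that also $\{\sigma_1,\sigma_m\}\neq\{\mathtt u,\mathtt o\}$. Compatibility: a cyclic signature $\tau$ is compatible with a cyclic signature $\sigma$ if for all $i=1,\ldots,m$: (1) $\sigma_i=\mathtt u\Rightarrow\tau_i=\mathtt o$; (2) $\sigma_i=\mathtt o\Rightarrow\tau_i\in\{\mathtt c,\mathtt o\}$; (3) $\tau_i=\mathtt c\Rightarrow(\sigma_i=\mathtt o)$ or $(\tau_{i-1}=\mathtt o)$ or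 $(\tau_{i+1}=\mathtt o)$, with indices $i\pm1$ taken modulo $m$. Transfer matrix: let $\mathtt o(\tau)$ be the number of entries of $\tau$ equal to $\mathtt o$. $\overline A=(\overline A_{\tau,\sigma})$, with rows $\tau$ and columns $\sigma$ ranging over all cyclic signatures of length $m$, is defined by $\overline A_{\tau,\sigma}=z^{\mathtt o(\tau)}$ if $\tau$ is compatible with $\sigma$, and $\overline A_{\tau,\sigma}=0$ otherwise. Entries lie in $\mathbb Z[z]$. *)

theory Defs
  imports
    "HOL-Computational_Algebra.Polynomial"
    "HOL-Number_Theory.Cong"
    "Jordan_Normal_Form.Matrix"
begin

(* A simple graph is a pair (V, E), where E is a set of two-element subsets of V. *)
type_synonym 'a graph = "'a set \<times> 'a set set"

definition dominating_set :: "'a graph \<Rightarrow> 'a set \<Rightarrow> bool" where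
  "dominating_set G S \<longleftrightarrow>
     S \<subseteq> fst G \<and> (\<forall>v \<in> fst G. v \<in> S \<or> (\<exists>w \<in> S. {v, w} \<in> snd G))"

(* Intended for finite vertex sets only: the sum over an infinite index set is 0. *)
definition domination_poly :: "'a graph \<Rightarrow> int poly" where
  "domination_poly G = (\<Sum>S \<in> {S. dominating_set G S}. monom 1 (card S))"

(* The vertices 0, ..., k-1 represent Z/k. The cycle on 1 vertex has no edge (no loop),
   the one on 2 vertices has a single edge. *)
definition cycle_graph :: "nat \<Rightarrow> nat graph" where
  "cycle_graph k =
     ({..<k},
      {{i, j} | i j. i < k \<and> j < k \<and> i \<noteq> j \<and>
         ([int j = int i + 1] (mod int k) \<or> [int j = int i - 1] (mod int k))})"

definition cartesian_product :: "'a graph \<Rightarrow> 'b graph \<Rightarrow> ('a \<times> 'b) graph" where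
  "cartesian_product G H =
     (fst G \<times> fst H,
      {{(a, b), (a, b')} | a b b'. a \<in> fst G \<and> {b, b'} \<in> snd H} \<union>
      {{(a, b), (a', b)} | a a' b. {a, a'} \<in> snd G \<and> b \<in> fst H})"

definition torus_graph :: "nat \<Rightarrow> nat \<Rightarrow> (nat \<times> nat) graph" where
  "torus_graph m n = cartesian_product (cycle_graph m) (cycle_graph n)"

datatype letter = Uncovered | Covered | Occupied

(* Strings are lists, so positions run from 0 to m - 1 instead of from 1 to m. *)
definition cyclic_signature :: "nat \<Rightarrow> letter list \<Rightarrow> bool" where
  "cyclic_signature m \<sigma> \<longleftrightarrow>
     length \<sigma> = m \<and>
     (\<forall>i. i + 1 < m \<longrightarrow>
        (\<sigma> ! i, \<sigma> ! (i + 1)) \<noteq> (Uncovered, Occupied) \<and>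
        (\<sigma> ! i, \<sigma> ! (i + 1)) \<noteq> (Occupied, Uncovered)) \<and>
     {\<sigma> ! 0, \<sigma> ! (m - 1)} \<noteq> {Uncovered, Occupied}"

(* i + m - 1 is the predecessor of i modulo m, written so that truncated subtraction
   on the naturals does no harm at i = 0. *)
definition compatible :: "nat \<Rightarrow> letter list \<Rightarrow> letter list \<Rightarrow> bool" where
  "compatible m \<tau> \<sigma> \<longleftrightarrow>
     (\<forall>i < m.
        (\<sigma> ! i = Uncovered \<longrightarrow> \<tau> ! i = Occupied) \<and>
        (\<sigma> ! i = Occupied \<longrightarrow> \<tau> ! i \<in> {Covered, Occupied}) \<and>
        (\<tau> ! i = Covered \<longrightarrow>
           \<sigma> ! i = Occupied \<or>
           \<tau> ! ((i + m - 1) mod m) = Occupied \<or>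
           \<tau> ! ((i + 1) mod m) = Occupied))"

(* Matrices are indexed by natural numbers, so the cyclic signatures are enumerated
   (in lexicographic order); by the two lemmas below each of them occurs exactly once. *)
definition cyclic_signatures :: "nat \<Rightarrow> letter list list" where
  "cyclic_signatures m =
     filter (cyclic_signature m) (List.n_lists m [Uncovered, Covered, Occupied])"

lemma set_cyclic_signatures: "set (cyclic_signatures m) = {\<sigma>. cyclic_signature m \<sigma>}"
proof -
  have "set \<sigma> \<subseteq> {Uncovered, Covered, Occupied}" for \<sigma>
    using letter.exhaust by blast
  then show ?thesis
    by (auto simp: cyclic_signatures_def set_n_lists cyclic_signature_def)
qed

lemma distinct_cyclic_signatures: "distinct (cyclic_signatures m)"
  by (simp add: cyclic_signatures_def distinct_n_lists)

definition transfer_entry :: "nat \<Rightarrow> letter list \<Rightarrow> letter list \<Rightarrow> int poly" where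
  "transfer_entry m \<tau> \<sigma> =
     (if compatible m \<tau> \<sigma> then monom 1 (count_list \<tau> Occupied) else 0)"

definition transfer_matrix :: "nat \<Rightarrow> int poly mat" where
  "transfer_matrix m =
     (let ss = cyclic_signatures m; N = length ss
      in mat N N (\<lambda>(i, j). transfer_entry m (ss ! i) (ss ! j)))"

definition mat_trace :: "'a :: comm_monoid_add mat \<Rightarrow> 'a" where
  "mat_trace A = (\<Sum>i < dim_row A. A $$ (i, i))"

end

theory Submission
  imports Defs
begin

text \<open>
  The trace of the \<open>n\<close>-th power of a matrix is the sum, over all closed walks of length \<open>n\<close> in
  its index set, of the product of the entries met along the walk
  (\<open>trace_matrix_power_eq_sum_closed_walks\<close>). For the transfer matrix only closed walks whose
  consecutive signatures are compatible survive, and such a walk contributes \<open>z\<close> raised to the number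
  of occupied letters in it. It therefore suffices to match these walks, one signature per column
  of the torus, with the dominating sets, in such a way that the occupied letters are the chosen
  vertices.

  A dominating set gives a walk by recording for every unchosen vertex whether it is dominated
  from its own column or from the preceding one (covered), or not yet (uncovered); domination says
  that an uncovered vertex is followed by a chosen one. Conversely, a walk is determined by its
  occupied letters. Compatibility gives every covered letter an occupied neighbour in its own or
  the preceding column. An uncovered letter has none: the definition of cyclic signatures excludes
  it in its own column, and compatibility with the preceding column excludes it there. Moreover an
  uncovered letter is followed by an occupied one, so the set of occupied cells dominates.

  The entry in row \<open>\<tau>\<close> and column \<open>\<sigma>\<close> describes the step from \<open>\<sigma>\<close> to \<open>\<tau>\<close>, so a walk that is read
  along the product of matrices visits the columns of the torus backwards: the column preceding
  \<open>k\<close> is \<open>k + 1\<close>. The reflection symmetry of the torus makes this as good as the other direction.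

  In cycles with one or two vertices, the cyclic successor and predecessor of a vertex may coincide
  with each other or with the vertex itself. Since a vertex dominates itself, domination can still be
  stated through cyclic successors and predecessors (\<open>dominating_set_torus_iff\<close>), and this covers the
  small tori as well.
\<close>


section \<open>Traces of matrix powers as sums over closed walks\<close>

text \<open>
  The last factor is split off so that the end point \<open>j\<close> appears only there. This lets the induction
  pass from \<open>n\<close> to \<open>n + 1\<close> by appending one vertex to the walk, and it leaves \<open>n + 1\<close> vertices,
  just the number that a closed walk of length \<open>n + 1\<close> has.
\<close>

lemma matrix_power_entry_eq_sum_walks:
  fixes f :: "'a \<Rightarrow> 'a \<Rightarrow> 'b :: comm_semiring_1"
  assumes "distinct ss" and i: "i < length ss" and "j < length ss"
  defines "A \<equiv> mat (length ss) (length ss) (\<lambda>(i, j). f (ss ! i) (ss ! j))"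
  shows "(A ^\<^sub>m Suc n) $$ (i, j) =
    (\<Sum>w \<in> {w \<in> {..<Suc n} \<rightarrow>\<^sub>E set ss. w 0 = ss ! i}.
       (\<Prod>k<n. f (w k) (w (Suc k))) * f (w n) (ss ! j))"
  using assms(3)
proof (induction n arbitrary: j)
  case 0
  have walks: "{w \<in> {..<Suc 0} \<rightarrow>\<^sub>E set ss. w 0 = ss ! i} = {\<lambda>k\<in>{..<Suc 0}. ss ! i}"
  proof (intro equalityI subsetI)
    fix w assume "w \<in> {w \<in> {..<Suc 0} \<rightarrow>\<^sub>E set ss. w 0 = ss ! i}"
    then have "w = (\<lambda>k\<in>{..<Suc 0}. ss ! i)"
      by (auto simp: PiE_iff extensional_def restrict_def)
    then show "w \<in> {\<lambda>k\<in>{..<Suc 0}. ss ! i}" by simp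
  qed (use i in auto)
  show ?case
    unfolding walks using i 0 by (simp add: A_def)
next
  case (Suc n)
  let ?W = "\<lambda>n. {w \<in> {..<Suc n} \<rightarrow>\<^sub>E set ss. w 0 = ss ! i}"
  let ?p = "\<lambda>n w. \<Prod>k<n. f (w k) (w (Suc k))"
  have dims: "A ^\<^sub>m Suc n \<in> carrier_mat (length ss) (length ss)" "A \<in> carrier_mat (length ss) (length ss)"
    by (auto simp: A_def intro!: pow_carrier_mat mult_carrier_mat)
  have "(A ^\<^sub>m Suc (Suc n)) $$ (i, j) = (\<Sum>l<length ss. (A ^\<^sub>m Suc n) $$ (i, l) * A $$ (l, j))"
    using dims i Suc.prems
    by (simp add: scalar_prod_def lessThan_atLeast0 del: pow_mat.simps
          add: pow_mat.simps(2)[of A "Suc n"])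
  also have "\<dots> = (\<Sum>l<length ss. \<Sum>w\<in>?W n. ?p n w * f (w n) (ss ! l) * f (ss ! l) (ss ! j))"
    using Suc.prems
    by (intro sum.cong refl, subst Suc.IH) (simp_all add: sum_distrib_right A_def)
  also have "\<dots> = (\<Sum>\<sigma>\<in>set ss. \<Sum>w\<in>?W n. ?p n w * f (w n) \<sigma> * f \<sigma> (ss ! j))"
    by (rule sum.reindex_bij_betw[OF bij_betw_nth[OF \<open>distinct ss\<close> refl refl]])
  also have "\<dots> = (\<Sum>(\<sigma>, w)\<in>set ss \<times> ?W n. ?p n w * f (w n) \<sigma> * f \<sigma> (ss ! j))"
    by (rule sum.cartesian_product)
  \<comment> \<open>The pair of a new last vertex and a walk becomes the extended walk.\<close>
  also have "\<dots> = (\<Sum>w\<in>?W (Suc n). ?p (Suc n) w * f (w (Suc n)) (ss ! j))"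
  proof (rule sum.reindex_bij_witness[where j = "\<lambda>(\<sigma>, w). w(Suc n := \<sigma>)"
          and i = "\<lambda>w. (w (Suc n), w(Suc n := undefined))"])
    fix a assume "a \<in> set ss \<times> ?W n"
    then obtain \<sigma> w where a: "a = (\<sigma>, w)" and \<sigma>: "\<sigma> \<in> set ss" and w: "w \<in> ?W n"
      by auto
    have "w (Suc n) = undefined"
      using w by (auto simp: PiE_iff extensional_def)
    then show "((case a of (\<sigma>, w) \<Rightarrow> w(Suc n := \<sigma>)) (Suc n),
        (case a of (\<sigma>, w) \<Rightarrow> w(Suc n := \<sigma>))(Suc n := undefined)) = a"
      by (simp add: a fun_upd_idem)
    show "(case a of (\<sigma>, w) \<Rightarrow> w(Suc n := \<sigma>)) \<in> ?W (Suc n)"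
      using \<sigma> w by (auto simp: a PiE_iff extensional_def)
    have "?p n (w(Suc n := \<sigma>)) = ?p n w"
      by (intro prod.cong) auto
    then show "?p (Suc n) (case a of (\<sigma>, w) \<Rightarrow> w(Suc n := \<sigma>)) *
          f ((case a of (\<sigma>, w) \<Rightarrow> w(Suc n := \<sigma>)) (Suc n)) (ss ! j) =
        (case a of (\<sigma>, w) \<Rightarrow> ?p n w * f (w n) \<sigma> * f \<sigma> (ss ! j))"
      by (simp add: a)
  next
    fix w assume w: "w \<in> ?W (Suc n)"
    show "(case (w (Suc n), w(Suc n := undefined)) of (\<sigma>, w) \<Rightarrow> w(Suc n := \<sigma>)) = w"
      by simp
    have "w k \<in> set ss" if "k < Suc (Suc n)" for k
      using w that by (auto simp: PiE_iff)
    moreover have "w k = undefined" if "k \<ge> Suc (Suc n)" for k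
      using w that by (auto simp: PiE_iff extensional_def)
    ultimately show "(w (Suc n), w(Suc n := undefined)) \<in> set ss \<times> ?W n"
      using w by (auto simp: PiE_iff extensional_def)
  qed
  finally show ?case .
qed

lemma trace_matrix_power_eq_sum_closed_walks:
  fixes f :: "'a \<Rightarrow> 'a \<Rightarrow> 'b :: comm_semiring_1"
  assumes "distinct ss" and "n \<ge> 1"
  shows "mat_trace (mat (length ss) (length ss) (\<lambda>(i, j). f (ss ! i) (ss ! j)) ^\<^sub>m n) =
    (\<Sum>w \<in> {..<n} \<rightarrow>\<^sub>E set ss. \<Prod>k<n. f (w k) (w ((k + 1) mod n)))"
proof -
  obtain n' where n: "n = Suc n'" using assms(2) by (cases n) auto
  let ?A = "mat (length ss) (length ss) (\<lambda>(i, j). f (ss ! i) (ss ! j))"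
  let ?g = "\<lambda>w. (\<Prod>k<n'. f (w k) (w (Suc k))) * f (w n') (w 0)"
  have "mat_trace (?A ^\<^sub>m n) = (\<Sum>i<length ss. (?A ^\<^sub>m Suc n') $$ (i, i))"
    unfolding mat_trace_def n by simp
  also have "\<dots> = (\<Sum>i<length ss. \<Sum>w \<in> {w \<in> {..<n} \<rightarrow>\<^sub>E set ss. w 0 = ss ! i}. ?g w)"
    unfolding n
    by (intro sum.cong refl, subst matrix_power_entry_eq_sum_walks[OF assms(1)]) auto
  also have "\<dots> = (\<Sum>\<sigma>\<in>set ss. \<Sum>w \<in> {w \<in> {..<n} \<rightarrow>\<^sub>E set ss. w 0 = \<sigma>}. ?g w)"
    by (rule sum.reindex_bij_betw[OF bij_betw_nth[OF assms(1) refl refl]])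
  also have "\<dots> = (\<Sum>w \<in> {..<n} \<rightarrow>\<^sub>E set ss. ?g w)"
    by (rule sum.group) (auto simp: n intro!: finite_PiE)
  also have "\<dots> = (\<Sum>w \<in> {..<n} \<rightarrow>\<^sub>E set ss. \<Prod>k<n. f (w k) (w ((k + 1) mod n)))"
    unfolding n by (intro sum.cong refl) simp
  finally show ?thesis .
qed


section \<open>Domination in the torus\<close>

definition cyc_succ :: "nat \<Rightarrow> nat \<Rightarrow> nat" where
  "cyc_succ k i = (i + 1) mod k"

definition cyc_pred :: "nat \<Rightarrow> nat \<Rightarrow> nat" where
  "cyc_pred k i = (i + k - 1) mod k"

lemma cyc_succ_less: "i < k \<Longrightarrow> cyc_succ k i < k"
  and cyc_pred_less: "i < k \<Longrightarrow> cyc_pred k i < k"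
  by (simp_all add: cyc_succ_def cyc_pred_def)

lemma cyc_succ_if: "i < k \<Longrightarrow> cyc_succ k i = (if i + 1 = k then 0 else i + 1)"
  by (simp add: cyc_succ_def)

lemma cyc_pred_if: "i < k \<Longrightarrow> cyc_pred k i = (if i = 0 then k - 1 else i - 1)"
  by (cases i) (simp_all add: cyc_pred_def)

lemma cyc_succ_pred: "i < k \<Longrightarrow> cyc_succ k (cyc_pred k i) = i"
  by (auto simp: cyc_pred_if cyc_succ_if)

lemma cyc_pred_succ: "i < k \<Longrightarrow> cyc_pred k (cyc_succ k i) = i"
  by (auto simp: cyc_succ_if cyc_pred_if)

lemma cong_succ_iff:
  assumes "i < k" "j < k"
  shows "[int j = int i + 1] (mod int k) \<longleftrightarrow> j = cyc_succ k i"
proof -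
  have "[int j = int i + 1] (mod int k) \<longleftrightarrow> [j = i + 1] (mod k)"
    using cong_int_iff[of j "i + 1" k] by (simp add: add.commute)
  also have "\<dots> \<longleftrightarrow> j = cyc_succ k i"
    using assms by (simp add: cong_def cyc_succ_def)
  finally show ?thesis .
qed

lemma cong_pred_iff:
  assumes "i < k" "j < k"
  shows "[int j = int i - 1] (mod int k) \<longleftrightarrow> j = cyc_pred k i"
proof -
  have "[int j = int i - 1] (mod int k) \<longleftrightarrow> [int i = int j + 1] (mod int k)"
    by (metis cong_add_rcancel cong_sym_eq diff_add_cancel)
  also have "\<dots> \<longleftrightarrow> i = cyc_succ k j"
    using assms by (intro cong_succ_iff)
  also have "\<dots> \<longleftrightarrow> j = cyc_pred k i"
    using assms cyc_succ_pred cyc_pred_succ by metis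
  finally show ?thesis .
qed

lemma cycle_graph_edge_iff:
  "{i, j} \<in> snd (cycle_graph k) \<longleftrightarrow>
     i < k \<and> j < k \<and> i \<noteq> j \<and> (j = cyc_succ k i \<or> j = cyc_pred k i)"
proof -
  have "{i, j} \<in> snd (cycle_graph k) \<longleftrightarrow>
     (\<exists>a b. {i, j} = {a, b} \<and> a < k \<and> b < k \<and> a \<noteq> b \<and> (b = cyc_succ k a \<or> b = cyc_pred k a))"
    unfolding cycle_graph_def by (simp add: cong_succ_iff cong_pred_iff cong: conj_cong)
  also have "\<dots> \<longleftrightarrow> i < k \<and> j < k \<and> i \<noteq> j \<and> (j = cyc_succ k i \<or> j = cyc_pred k i)"
    by (metis doubleton_eq_iff cyc_succ_pred cyc_pred_succ)
  finally show ?thesis .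
qed

lemma torus_edge_iff:
  "{(i, k), (i', k')} \<in> snd (torus_graph m n) \<longleftrightarrow>
     i = i' \<and> i < m \<and> {k, k'} \<in> snd (cycle_graph n) \<or>
     k = k' \<and> k < n \<and> {i, i'} \<in> snd (cycle_graph m)"
proof -
  have V: "fst (cycle_graph r) = {..<r}" for r
    by (simp add: cycle_graph_def)
  have vertical: "{(i, k), (i', k')} = {(a, b), (a, b')} \<longleftrightarrow> i = a \<and> i' = a \<and> {k, k'} = {b, b'}"
    for a b b' by (auto simp: doubleton_eq_iff)
  have horizontal: "{(i, k), (i', k')} = {(a, b), (a', b)} \<longleftrightarrow> k = b \<and> k' = b \<and> {i, i'} = {a, a'}"
    for a a' b by (auto simp: doubleton_eq_iff)
  show ?thesis
    unfolding torus_graph_def cartesian_product_def snd_conv Un_iff mem_Collect_eq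
      vertical horizontal V lessThan_iff
    by metis
qed

text \<open>
  On small cycles some of the four cells next to \<open>(i, k)\<close> coincide with it or with each other.
\<close>

definition torus_dominated :: "nat \<Rightarrow> nat \<Rightarrow> (nat \<times> nat) set \<Rightarrow> nat \<Rightarrow> nat \<Rightarrow> bool" where
  "torus_dominated m n S i k \<longleftrightarrow>
     (i, k) \<in> S \<or> (cyc_pred m i, k) \<in> S \<or> (cyc_succ m i, k) \<in> S \<or>
     (i, cyc_pred n k) \<in> S \<or> (i, cyc_succ n k) \<in> S"

text \<open>
  Adjacency in the torus requires the cyclic successor or predecessor to differ from the vertex.
  When it does not, its membership in \<open>S\<close> is the first disjunct of \<open>torus_dominated\<close>, so both sides
  agree on small cycles too.
\<close>

lemma dominating_set_torus_iff:
  "dominating_set (torus_graph m n) S \<longleftrightarrow>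
     S \<subseteq> {..<m} \<times> {..<n} \<and> (\<forall>i<m. \<forall>k<n. torus_dominated m n S i k)"
proof -
  have V: "fst (torus_graph m n) = {..<m} \<times> {..<n}"
    by (simp add: torus_graph_def cartesian_product_def cycle_graph_def)
  have "(i, k) \<in> S \<or> (\<exists>v\<in>S. {(i, k), v} \<in> snd (torus_graph m n)) \<longleftrightarrow> torus_dominated m n S i k"
    if "i < m" "k < n" for i k
  proof -
    have "(\<exists>v\<in>S. {(i, k), v} \<in> snd (torus_graph m n)) \<longleftrightarrow>
      (\<exists>k'. (i, k') \<in> S \<and> k' < n \<and> k \<noteq> k' \<and> (k' = cyc_succ n k \<or> k' = cyc_pred n k)) \<or>
      (\<exists>i'. (i', k) \<in> S \<and> i' < m \<and> i \<noteq> i' \<and> (i' = cyc_succ m i \<or> i' = cyc_pred m i))"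
      using that by (auto simp: Bex_def torus_edge_iff cycle_graph_edge_iff)
    then show ?thesis
      unfolding torus_dominated_def
      using cyc_succ_less[OF that(1)] cyc_pred_less[OF that(1)]
        cyc_succ_less[OF that(2)] cyc_pred_less[OF that(2)]
      by auto
  qed
  then show ?thesis
    unfolding dominating_set_def V by auto
qed


section \<open>Dominating sets as closed walks of signatures\<close>

text \<open>
  The exclusion of both orders of the letters in neighbouring positions, and the separate condition
  on the two ends, become one local condition at the uncovered letters.
\<close>

lemma cyclic_signature_iff:
  assumes "m \<ge> 1"
  shows "cyclic_signature m \<sigma> \<longleftrightarrow> length \<sigma> = m \<and>
    (\<forall>i<m. \<sigma> ! i = Uncovered \<longrightarrow>
       \<sigma> ! cyc_pred m i \<noteq> Occupied \<and> \<sigma> ! cyc_succ m i \<noteq> Occupied)"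
  (is "?L \<longleftrightarrow> ?R")
proof
  assume L: ?L
  have "\<sigma> ! cyc_pred m i \<noteq> Occupied \<and> \<sigma> ! cyc_succ m i \<noteq> Occupied"
    if "i < m" "\<sigma> ! i = Uncovered" for i
  proof
    show "\<sigma> ! cyc_pred m i \<noteq> Occupied"
    proof (cases i)
      case 0
      then show ?thesis
        using L that by (auto simp: cyclic_signature_def cyc_pred_if)
    next
      case (Suc i')
      then show ?thesis
        using L that by (auto simp: cyclic_signature_def cyc_pred_if)
    qed
    show "\<sigma> ! cyc_succ m i \<noteq> Occupied"
    proof (cases "i + 1 = m")
      case True
      then have "i = m - 1" by simp
      then show ?thesis
        using L that True by (auto simp: cyclic_signature_def cyc_succ_if)
    next
      case False
      then show ?thesis
        using L that by (auto simp: cyclic_signature_def cyc_succ_if)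
    qed
  qed
  then show ?R using L by (simp add: cyclic_signature_def)
next
  assume R: ?R
  have "(\<sigma> ! i, \<sigma> ! (i + 1)) \<noteq> (Uncovered, Occupied) \<and>
        (\<sigma> ! i, \<sigma> ! (i + 1)) \<noteq> (Occupied, Uncovered)" if "i + 1 < m" for i
    using R[THEN conjunct2, rule_format, of i] R[THEN conjunct2, rule_format, of "i + 1"] that
    by (auto simp: cyc_succ_if cyc_pred_if)
  moreover have "{\<sigma> ! 0, \<sigma> ! (m - 1)} \<noteq> {Uncovered, Occupied}"
    using R[THEN conjunct2, rule_format, of 0] R[THEN conjunct2, rule_format, of "m - 1"] assms
    by (auto simp: cyc_succ_if cyc_pred_if doubleton_eq_iff)
  ultimately show ?L
    using R by (simp add: cyclic_signature_def)
qed

text \<open>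
  The column from which a cell may already be covered is \<open>cyc_succ n k\<close>, not \<open>cyc_pred n k\<close>,
  because closed walks traverse the torus backwards.
\<close>

definition column_signature ::
    "nat \<Rightarrow> nat \<Rightarrow> (nat \<times> nat) set \<Rightarrow> nat \<Rightarrow> letter list" where
  "column_signature m n S k =
     map (\<lambda>i. if (i, k) \<in> S then Occupied
              else if (cyc_pred m i, k) \<in> S \<or> (cyc_succ m i, k) \<in> S \<or> (i, cyc_succ n k) \<in> S
              then Covered else Uncovered) [0..<m]"

definition closed_walks :: "nat \<Rightarrow> nat \<Rightarrow> (nat \<Rightarrow> letter list) set" where
  "closed_walks m n =
     {w \<in> {..<n} \<rightarrow>\<^sub>E {\<sigma>. cyclic_signature m \<sigma>}. \<forall>k<n. compatible m (w k) (w (cyc_succ n k))}"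

definition occupied_cells :: "nat \<Rightarrow> nat \<Rightarrow> (nat \<Rightarrow> letter list) \<Rightarrow> (nat \<times> nat) set" where
  "occupied_cells m n w = {(i, k). i < m \<and> k < n \<and> w k ! i = Occupied}"

lemma length_column_signature [simp]: "length (column_signature m n S k) = m"
  by (simp add: column_signature_def)

lemma column_signature_nth:
  "i < m \<Longrightarrow> column_signature m n S k ! i =
     (if (i, k) \<in> S then Occupied
      else if (cyc_pred m i, k) \<in> S \<or> (cyc_succ m i, k) \<in> S \<or> (i, cyc_succ n k) \<in> S
      then Covered else Uncovered)"
  by (simp add: column_signature_def)

lemma compatible_iff:
  "compatible m \<tau> \<sigma> \<longleftrightarrow>
     (\<forall>i < m.
        (\<sigma> ! i = Uncovered \<longrightarrow> \<tau> ! i = Occupied) \<and>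
        (\<sigma> ! i = Occupied \<longrightarrow> \<tau> ! i \<noteq> Uncovered) \<and>
        (\<tau> ! i = Covered \<longrightarrow>
           \<sigma> ! i = Occupied \<or> \<tau> ! cyc_pred m i = Occupied \<or> \<tau> ! cyc_succ m i = Occupied))"
proof -
  have "x \<in> {Covered, Occupied} \<longleftrightarrow> x \<noteq> Uncovered" for x
    by (cases x) auto
  then show ?thesis
    unfolding compatible_def cyc_pred_def cyc_succ_def by simp
qed

text \<open>
  Domination of \<open>S\<close> enters where an uncovered letter has to be followed by an occupied one: an
  uncovered cell of column \<open>cyc_succ n k\<close> must still be dominated, and the only cell left to do it is
  the one in column \<open>k\<close>. The rest is immediate from the choice of the letters.
\<close>

lemma column_signatures_closed_walk:
  assumes "m \<ge> 1" and S: "dominating_set (torus_graph m n) S"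
  shows "(\<lambda>k\<in>{..<n}. column_signature m n S k) \<in> closed_walks m n"
proof -
  have "cyclic_signature m (column_signature m n S k)" for k
    unfolding cyclic_signature_iff[OF assms(1)]
    by (auto simp: column_signature_nth cyc_succ_less cyc_pred_less)
  moreover have "compatible m (column_signature m n S k) (column_signature m n S (cyc_succ n k))"
    if "k < n" for k
  proof -
    have "torus_dominated m n S i (cyc_succ n k)" if "i < m" for i
      using S that \<open>k < n\<close> cyc_succ_less unfolding dominating_set_torus_iff by blast
    then show ?thesis
      unfolding compatible_iff torus_dominated_def
      using that by (auto simp: column_signature_nth cyc_succ_less cyc_pred_less cyc_pred_succ)
  qed
  ultimately show ?thesis
    by (auto simp: closed_walks_def cyc_succ_less)
qed

text \<open>
  A covered letter is dominated because of the compatibility of its column with the preceding one,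
  an uncovered letter because of the compatibility of the following column with its own.
\<close>

lemma occupied_cells_dominating:
  assumes w: "w \<in> closed_walks m n"
  shows "dominating_set (torus_graph m n) (occupied_cells m n w)"
  unfolding dominating_set_torus_iff
proof (intro conjI allI impI)
  show "occupied_cells m n w \<subseteq> {..<m} \<times> {..<n}"
    by (auto simp: occupied_cells_def)
next
  fix i k assume ik: "i < m" "k < n"
  have compat: "compatible m (w k) (w (cyc_succ n k))" if "k < n" for k
    using w that by (simp add: closed_walks_def)
  note C = compat[OF ik(2), unfolded compatible_iff, rule_format, OF ik(1)]
  \<comment> \<open>The column that follows \<open>k\<close> is \<open>cyc_pred n k\<close>.\<close>
  note D = compat[OF cyc_pred_less[OF ik(2)], unfolded compatible_iff cyc_succ_pred[OF ik(2)],
      rule_format, OF ik(1)]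
  show "torus_dominated m n (occupied_cells m n w) i k"
    unfolding torus_dominated_def occupied_cells_def
    using ik C D by (cases "w k ! i") (auto simp: cyc_succ_less cyc_pred_less)
qed

lemma occupied_cells_column_signature:
  assumes "dominating_set (torus_graph m n) S"
  shows "occupied_cells m n (\<lambda>k\<in>{..<n}. column_signature m n S k) = S"
  using assms unfolding dominating_set_torus_iff
  by (auto simp: occupied_cells_def column_signature_nth split: if_splits)

text \<open>
  A walk is determined by its occupied letters: among the other letters, the covered ones are
  exactly those with an occupied neighbour in their own or the preceding column. Covered letters have
  one by compatibility; uncovered letters have none, by the definition of cyclic signatures for their
  own column and by compatibility for the preceding one.
\<close>

lemma column_signature_occupied_cells:
  assumes "m \<ge> 1" and w: "w \<in> closed_walks m n"
  shows "(\<lambda>k\<in>{..<n}. column_signature m n (occupied_cells m n w) k) = w"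
proof
  fix k
  show "(\<lambda>k\<in>{..<n}. column_signature m n (occupied_cells m n w) k) k = w k"
  proof (cases "k < n")
    case True
    then have sig: "cyclic_signature m (w k)"
      and compat: "compatible m (w k) (w (cyc_succ n k))"
      using w by (auto simp: closed_walks_def)
    have "column_signature m n (occupied_cells m n w) k = w k"
    proof (rule nth_equalityI)
      show "length (column_signature m n (occupied_cells m n w) k) = length (w k)"
        using sig by (simp add: cyclic_signature_def)
      fix i assume "i < length (column_signature m n (occupied_cells m n w) k)"
      then have "i < m" by simp
      then show "column_signature m n (occupied_cells m n w) k ! i = w k ! i"
        using sig compat True
        unfolding cyclic_signature_iff[OF assms(1)] compatible_iff
        by (cases "w k ! i")
           (auto simp: column_signature_nth occupied_cells_def cyc_succ_less cyc_pred_less)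
    qed
    then show ?thesis using True by simp
  next
    case False
    have "w \<in> {..<n} \<rightarrow>\<^sub>E {\<sigma>. cyclic_signature m \<sigma>}"
      using w by (simp add: closed_walks_def)
    from PiE_arb[OF this, of k] False show ?thesis by simp
  qed
qed

lemma card_occupied_cells:
  assumes "w \<in> closed_walks m n"
  shows "card (occupied_cells m n w) = (\<Sum>k<n. count_list (w k) Occupied)"
proof -
  have "count_list (w k) Occupied = card {i. i < m \<and> w k ! i = Occupied}" if "k < n" for k
  proof -
    have "length (w k) = m"
      using assms that by (auto simp: closed_walks_def cyclic_signature_def)
    then show ?thesis
      unfolding count_list_eq_length_filter length_filter_conv_card
      by (intro arg_cong[of _ _ card]) auto
  qed
  then have "(\<Sum>k<n. count_list (w k) Occupied) = (\<Sum>k<n. card {i. i < m \<and> w k ! i = Occupied})"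
    by simp
  also have "\<dots> = card (SIGMA k:{..<n}. {i. i < m \<and> w k ! i = Occupied})"
    by (subst card_SigmaI) auto
  also have "\<dots> = card (occupied_cells m n w)"
    by (rule bij_betw_same_card[where f = "\<lambda>(k, i). (i, k)"])
       (auto simp: bij_betw_def inj_on_def occupied_cells_def)
  finally show ?thesis by simp
qed

lemma prod_transfer_entry:
  "(\<Prod>k<n. transfer_entry m (w k) (w (cyc_succ n k))) =
     (if \<forall>k<n. compatible m (w k) (w (cyc_succ n k))
      then monom 1 (\<Sum>k<n. count_list (w k) Occupied) else 0)"
proof -
  have "(\<Prod>k\<in>K. monom (1::int) (c k)) = monom 1 (\<Sum>k\<in>K. c k)" if "finite K" for K :: "nat set" and c
    using that by induction (simp_all add: mult_monom)
  then show ?thesis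
    by (auto simp: transfer_entry_def intro!: prod_zero)
qed

theorem theorem8:
  fixes m n :: nat
  assumes "m \<ge> 1" and "n \<ge> 1"
  shows "domination_poly (torus_graph m n) = mat_trace (transfer_matrix m ^\<^sub>m n)"
proof -
  let ?Sig = "{\<sigma>. cyclic_signature m \<sigma>}"
  have fin: "finite ({..<n} \<rightarrow>\<^sub>E ?Sig)"
    unfolding set_cyclic_signatures[symmetric] by (intro finite_PiE) auto
  have "mat_trace (transfer_matrix m ^\<^sub>m n) =
      (\<Sum>w \<in> {..<n} \<rightarrow>\<^sub>E ?Sig. \<Prod>k<n. transfer_entry m (w k) (w (cyc_succ n k)))"
    unfolding transfer_matrix_def Let_def cyc_succ_def
    using trace_matrix_power_eq_sum_closed_walks[OF distinct_cyclic_signatures assms(2)]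
    by (simp only: set_cyclic_signatures)
  also have "\<dots> = (\<Sum>w \<in> closed_walks m n. monom 1 (\<Sum>k<n. count_list (w k) Occupied))"
    unfolding prod_transfer_entry closed_walks_def
    by (rule sum.inter_filter[OF fin, symmetric])
  also have "\<dots> = (\<Sum>w \<in> closed_walks m n. monom 1 (card (occupied_cells m n w)))"
    by (simp add: card_occupied_cells)
  also have "\<dots> = (\<Sum>S \<in> {S. dominating_set (torus_graph m n) S}. monom 1 (card S))"
    by (rule sum.reindex_bij_witness[where j = "occupied_cells m n"
          and i = "\<lambda>S. \<lambda>k\<in>{..<n}. column_signature m n S k"])
       (use assms(1) in \<open>simp_all add: occupied_cells_column_signature
          column_signature_occupied_cells occupied_cells_dominating column_signatures_closed_walk\<close>)
  finally show ?thesis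
    by (simp add: domination_poly_def)
qed

end
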